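(* Let $n\ge 4$ and write $n=2m+1$ or $n=2m$ with $m\in\{2,3,\dots\}$. Let $p>1$, let $F\in C^1(\mathbb{R})$ satisfy $F(s)\ge A s^p$ for all $s\ge0$ for some constant $A>0$, and let $0<\kappa<\kappa_0:=\frac{2}{p-1}$. Let $f\in C^2(0,\infty)$, $g\in C^1(0,\infty)$ and suppose there is a constant $R>0$ such that: (odd case $n=2m+1$) either there is $C_1>0$ with $$f(r)\ge \frac{C_1}{(1+r)^\kappa},\quad g(r)>0,\quad -C_{1,m}\frac{f(r)}{r}+g(r)>0\quad\text{for } r\ge R,$$ or there is $C_2>0$ with $$f(r)>0,\quad g(r)>0,\quad -C_{1,m}\frac{f(r)}{r}+g(r)\ge \frac{C_2}{(1+r)^{1+\kappa}}\quad\text{for } r\ge R;$$ (even case $n=2m$) there is $C_3>0$ with $$f(r)>0,\quad g(r)>0,\quad -C_{2,m}\frac{f(r)}{r}-|f'(r)|+\frac12 g(r)\ge \frac{C_3}{(1+r)^{1+\kappa}}\quad\text{for } r\ge R.$$ Let $u=u(r,t)$ be a solution of the radially symmetric Cauchy problem $$u_{tt}-\frac{n-1}{r}u_r-u_{rr}=F(u)\ \text{ in }(0,\infty)\times[0,\infty),\qquad u(r,0)=f(r),\ u_t(r,0)=g(r)\ \text{ in }(0,\infty).$$ Then $u$ cannot exist globally in time.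
   Context: $C_{1,m}=m(m-1)$ and $C_{2,m}=m-\frac38+\frac{5\zeta_m(m-1)^2}{3}$, where $\zeta_m\in(0,1]$ is a fixed constant depending only on $m$ such that the Chebyshev polynomial $T_{m-1}$ satisfies $\frac12\le T_{m-1}(z)\le 1$ and $0<T_{m-1}'(z)\le (m-1)^2$ for all $\frac{1}{1+\zeta_m}\le z\le 1$ (one may take $\zeta_2=1$). Here $T_k(z)=\frac{(-1)^k}{(2k-1)!!}(1-z^2)^{1/2}\frac{d^k}{dz^k}(1-z^2)^{k-1/2}$. "Cannot exist globally in time" means there is no (classical) solution defined for all $t\in[0,\infty)$. *)

theory Defs
  imports "HOL-Analysis.Analysis"
begin

definition odd_double_fact :: "nat \<Rightarrow> real" where
  "odd_double_fact k = (\<Prod>i<k. real (2*i+1))"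

(* Chebyshev polynomial via the Rodrigues-type formula of the paper
   (meaningful for -1 < z < 1) *)
definition cheb :: "nat \<Rightarrow> real \<Rightarrow> real" where
  "cheb k z = (-1)^k / odd_double_fact k * sqrt (1 - z^2) *
      ((deriv ^^ k) (\<lambda>w. (1 - w^2) powr (real k - 1/2)) z)"

definition zeta_admissible :: "nat \<Rightarrow> real \<Rightarrow> bool" where
  "zeta_admissible m \<zeta> \<longleftrightarrow> 0 < \<zeta> \<and> \<zeta> \<le> 1 \<and>
     (\<forall>z. 1/(1+\<zeta>) \<le> z \<and> z < 1 \<longrightarrow>
        1/2 \<le> cheb (m-1) z \<and> cheb (m-1) z \<le> 1 \<and>
        0 < deriv (cheb (m-1)) z \<and> deriv (cheb (m-1)) z \<le> (real m - 1)^2)"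

definition C1m :: "nat \<Rightarrow> real" where
  "C1m m = real m * (real m - 1)"

definition C2m :: "nat \<Rightarrow> real \<Rightarrow> real" where
  "C2m m \<zeta> = real m - 3/8 + 5 * \<zeta> * (real m - 1)^2 / 3"

definition radial_solution ::
  "nat \<Rightarrow> (real \<Rightarrow> real) \<Rightarrow> (real \<Rightarrow> real) \<Rightarrow> (real \<Rightarrow> real) \<Rightarrow> (real \<Rightarrow> real \<Rightarrow> real) \<Rightarrow> bool" where
  "radial_solution n F f g u \<longleftrightarrow>
     (\<exists>ur ut urr utt urt :: real \<Rightarrow> real \<Rightarrow> real.
       (\<forall>r>0. \<forall>t\<ge>0.
          ((\<lambda>\<rho>. u \<rho> t) has_real_derivative ur r t) (at r) \<and>
          ((\<lambda>\<tau>. u r \<tau>) has_real_derivative ut r t) (at t within {0..}) \<and>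
          ((\<lambda>\<rho>. ur \<rho> t) has_real_derivative urr r t) (at r) \<and>
          ((\<lambda>\<tau>. ut r \<tau>) has_real_derivative utt r t) (at t within {0..}) \<and>
          ((\<lambda>\<tau>. ur r \<tau>) has_real_derivative urt r t) (at t within {0..}) \<and>
          utt r t - (real n - 1) / r * ur r t - urr r t = F (u r t)) \<and>
       continuous_on ({0<..} \<times> {0..}) (\<lambda>(r,t). u r t) \<and>
       continuous_on ({0<..} \<times> {0..}) (\<lambda>(r,t). ur r t) \<and>
       continuous_on ({0<..} \<times> {0..}) (\<lambda>(r,t). ut r t) \<and>
       continuous_on ({0<..} \<times> {0..}) (\<lambda>(r,t). urr r t) \<and>
       continuous_on ({0<..} \<times> {0..}) (\<lambda>(r,t). utt r t) \<and>
       continuous_on ({0<..} \<times> {0..}) (\<lambda>(r,t). urt r t) \<and>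
       (\<forall>r>0. u r 0 = f r \<and> ut r 0 = g r))"

end

theory Submission
  imports Defs
begin

text \<open>
  Write \<open>a = (n - 1) / 2\<close> and \<open>v = r\<^sup>a u\<close>, so that \<open>v\<^sub>t\<^sub>t - v\<^sub>r\<^sub>r = r\<^sup>a F(u) - a (a - 1) v / r\<^sup>2\<close>.
  By scaling, data of size \<open>\<Lambda>\<^sup>-\<^sup>\<kappa>\<close> at radius \<open>\<Lambda>\<close> with \<open>\<kappa> < 2 / (p - 1)\<close> force blow-up before
  time \<open>\<epsilon> \<Lambda>\<close>, for any fixed \<open>\<epsilon> > 0\<close>, once \<open>\<Lambda>\<close> is large. It therefore suffices to look at times
  \<open>t \<le> \<epsilon> r\<close>, where the potential \<open>a (a - 1) / r\<^sup>2\<close> is a small perturbation of the one-dimensional wave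
  operator: as long as \<open>v \<ge> 0\<close>, the d'Alembert-Duhamel solution without potential dominates \<open>v\<close>,
  and feeding this back shows that \<open>v\<close> is at least about half of it. This gives positivity of \<open>u\<close>
  (at a first zero the bound is violated), a lower bound of order \<open>\<Lambda>\<^sup>-\<^sup>\<kappa>\<close>, and then, iterating
  \<open>u \<ge> const \<integral>\<integral> u\<^sup>p\<close> over backward triangles, arbitrarily large lower bounds at one point.
\<close>

section \<open>The chain rule along characteristics and d'Alembert's formula\<close>

text \<open>Joint differentiability follows from one partial derivative at the point itself and
  continuity of the other one nearby, so one-sided time derivatives at the ends of the interval
  cause no trouble. It is used with \<open>\<beta> = 1\<close> and \<open>\<beta> = -1\<close>, the
  two characteristic directions.\<close>

lemma has_real_derivative_along_line:
  fixes \<Phi> \<Phi>x :: "real \<Rightarrow> real \<Rightarrow> real"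
  assumes Y: "convex Y" and s: "s \<in> {a..b}"
    and line: "\<And>\<sigma>. \<sigma> \<in> {a..b} \<Longrightarrow> \<alpha> + \<beta> * \<sigma> \<in> Y"
    and dt: "((\<lambda>\<sigma>. \<Phi> (\<alpha> + \<beta> * s) \<sigma>) has_real_derivative D) (at s within {a..b})"
    and dx: "\<And>x \<sigma>. x \<in> Y \<Longrightarrow> \<sigma> \<in> {a..b} \<Longrightarrow>
               ((\<lambda>x. \<Phi> x \<sigma>) has_real_derivative \<Phi>x x \<sigma>) (at x within Y)"
    and cont: "continuous_on (Y \<times> {a..b}) (\<lambda>(x, \<sigma>). \<Phi>x x \<sigma>)"
  shows "((\<lambda>\<sigma>. \<Phi> (\<alpha> + \<beta> * \<sigma>) \<sigma>) has_real_derivative D + \<beta> * \<Phi>x (\<alpha> + \<beta> * s) s)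
           (at s within {a..b})"
proof -
  let ?y = "\<alpha> + \<beta> * s"
  have cont': "continuous_on ({a..b} \<times> Y) (\<lambda>q. blinfun_mult_right ((\<lambda>(x, \<sigma>). \<Phi>x x \<sigma>) (snd q, fst q)))"
    by (intro continuous_intros bounded_linear.continuous_on[OF bounded_linear_blinfun_mult_right]
        continuous_on_compose2[OF cont]) auto
  have deriv: "((\<lambda>(\<sigma>, y). \<Phi> y \<sigma>) has_derivative
      (\<lambda>(tx, ty). D * tx + blinfun_mult_right (\<Phi>x ?y s) ty)) (at (s, ?y) within {a..b} \<times> Y)"
  proof (rule has_derivative_partialsI[where fy = "\<lambda>\<sigma> y. blinfun_mult_right (\<Phi>x y \<sigma>)"])
    show "((\<lambda>x. \<Phi> ?y x) has_derivative (*) D) (at s within {a..b})"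
      using dt by (simp add: has_field_derivative_def)
    show "((\<lambda>y. \<Phi> y x) has_derivative blinfun_apply (blinfun_mult_right (\<Phi>x y x))) (at y within Y)"
      if "x \<in> {a..b}" "y \<in> Y" for x y
      using dx[OF that(2,1)] by (simp add: has_field_derivative_def)
    show "continuous (at (s, ?y) within {a..b} \<times> Y) (\<lambda>(x, y). blinfun_mult_right (\<Phi>x y x))"
      using cont' s line[OF s] by (simp add: continuous_on_eq_continuous_within case_prod_unfold)
  qed (use Y line s in auto)
  have "((\<lambda>\<sigma>. (\<sigma>, \<alpha> + \<beta> * \<sigma>)) has_derivative (\<lambda>h. (h, \<beta> * h))) (at s within {a..b})"
    by (auto intro!: derivative_eq_intros)
  from has_derivative_in_compose[OF this has_derivative_subset[OF deriv]]
  have "((\<lambda>\<sigma>. (\<lambda>(\<sigma>, y). \<Phi> y \<sigma>) (\<sigma>, \<alpha> + \<beta> * \<sigma>)) has_derivative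
      (\<lambda>h. (\<lambda>(tx, ty). D * tx + blinfun_mult_right (\<Phi>x ?y s) ty) (h, \<beta> * h))) (at s within {a..b})"
    using line by blast
  then have "((\<lambda>\<sigma>. \<Phi> (\<alpha> + \<beta> * \<sigma>) \<sigma>) has_derivative (\<lambda>h. D * h + \<Phi>x ?y s * (\<beta> * h))) (at s within {a..b})"
    by simp
  then show ?thesis
    unfolding has_field_derivative_def by (rule has_derivative_eq_rhs) (auto simp: algebra_simps)
qed

text \<open>The source is written as \<open>vtt - vxx\<close> rather than as a given function, which
  makes the formula an identity for every regular enough \<open>v\<close>; the equation is inserted
  later.\<close>

lemma dalembert:
  fixes v vx vt vxx vtt :: "real \<Rightarrow> real \<Rightarrow> real"
  assumes dx: "\<And>x t. x > 0 \<Longrightarrow> t \<ge> 0 \<Longrightarrow> ((\<lambda>x. v x t) has_real_derivative vx x t) (at x)"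
    and dxx: "\<And>x t. x > 0 \<Longrightarrow> t \<ge> 0 \<Longrightarrow> ((\<lambda>x. vx x t) has_real_derivative vxx x t) (at x)"
    and dt: "\<And>x t. x > 0 \<Longrightarrow> t \<ge> 0 \<Longrightarrow> ((\<lambda>t. v x t) has_real_derivative vt x t) (at t within {0..})"
    and dtt: "\<And>x t. x > 0 \<Longrightarrow> t \<ge> 0 \<Longrightarrow> ((\<lambda>t. vt x t) has_real_derivative vtt x t) (at t within {0..})"
    and cx: "continuous_on ({0<..} \<times> {0..}) (\<lambda>(x, t). vx x t)"
    and ct: "continuous_on ({0<..} \<times> {0..}) (\<lambda>(x, t). vt x t)"
    and ctt: "continuous_on ({0<..} \<times> {0..}) (\<lambda>(x, t). vtt x t)"
    and r: "0 \<le> t" "t < r"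
  shows "((\<lambda>s. integral {r - t + s..r + t - s} (\<lambda>x. vtt x s - vxx x s) / 2) has_integral
           v r t - (v (r - t) 0 + v (r + t) 0) / 2 - integral {r - t..r + t} (\<lambda>x. vt x 0) / 2) {0..t}"
proof -
  define l where "l = r - t"
  define b where "b = r + t"
  have lb: "0 < l" "l \<le> b" using r by (auto simp: l_def b_def)
  have slice: "continuous_on {c..d} (\<lambda>x. w x s)"
    if "continuous_on ({0<..} \<times> {0..}) (\<lambda>(x, t). w x t)" "0 \<le> s" "0 < c"
    for w :: "real \<Rightarrow> real \<Rightarrow> real" and s c d
    by (rule continuous_on_compose2[OF that(1), of _ "\<lambda>x. (x, s)", simplified])
      (use that in \<open>auto intro!: continuous_intros\<close>)
  \<comment> \<open>\<open>E s\<close> is d'Alembert's formula for \<open>v r t\<close> with data prescribed at time \<open>s\<close>; it is constant in \<open>s\<close> up to the source term.\<close>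
  define G where "G x s = integral {l..x} (\<lambda>y. vt y s)" for x s
  define E where "E s = (v (l + s) s + v (b - s) s + G (b - s) s - G (l + s) s) / 2" for s
  have G_add: "G y s - G x s = integral {x..y} (\<lambda>z. vt z s)" if "l \<le> x" "x \<le> y" "0 \<le> s" for x y s
    using Henstock_Kurzweil_Integration.integral_combine[OF that(1,2) integrable_continuous_real[OF slice[OF ct that(3) lb(1)]]]
    by (simp add: G_def)
  have box: "{l..b} \<times> {0..t} \<subseteq> {0<..} \<times> {0..}" using lb by auto
  have dv: "((\<lambda>\<sigma>. v (\<alpha> + \<beta> * \<sigma>) \<sigma>) has_real_derivative vt (\<alpha> + \<beta> * s) s + \<beta> * vx (\<alpha> + \<beta> * s) s)
      (at s within {0..t})"
    if "s \<in> {0..t}" "\<And>\<sigma>. \<sigma> \<in> {0..t} \<Longrightarrow> \<alpha> + \<beta> * \<sigma> \<in> {l..b}" for \<alpha> \<beta> s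
  proof (rule has_real_derivative_along_line[OF _ that])
    have "\<alpha> + \<beta> * s > 0" using that(2)[OF that(1)] lb by auto
    then show "(v (\<alpha> + \<beta> * s) has_real_derivative vt (\<alpha> + \<beta> * s) s) (at s within {0..t})"
      using that(1) by (auto intro: DERIV_subset[OF dt])
    show "((\<lambda>x. v x \<sigma>) has_real_derivative vx x \<sigma>) (at x within {l..b})"
      if "x \<in> {l..b}" "\<sigma> \<in> {0..t}" for x \<sigma>
      using that lb by (auto intro: DERIV_subset[OF dx])
  qed (use continuous_on_subset[OF cx box] in auto)
  \<comment> \<open>In time, \<open>G\<close> is differentiated under the integral sign; in its
    upper limit, by the fundamental theorem of calculus.\<close>
  have dG: "((\<lambda>\<sigma>. G (\<alpha> + \<beta> * \<sigma>) \<sigma>) has_real_derivative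
        integral {l..\<alpha> + \<beta> * s} (\<lambda>y. vtt y s) + \<beta> * vt (\<alpha> + \<beta> * s) s) (at s within {0..t})"
    if "s \<in> {0..t}" "\<And>\<sigma>. \<sigma> \<in> {0..t} \<Longrightarrow> \<alpha> + \<beta> * \<sigma> \<in> {l..b}" for \<alpha> \<beta> s
  proof (rule has_real_derivative_along_line[OF _ that])
    have le: "l \<le> \<alpha> + \<beta> * s" "\<alpha> + \<beta> * s \<le> b" using that(2)[OF that(1)] by auto
    show "(G (\<alpha> + \<beta> * s) has_real_derivative integral {l..\<alpha> + \<beta> * s} (\<lambda>y. vtt y s)) (at s within {0..t})"
      unfolding G_def box_real[symmetric]
    proof (rule leibniz_rule_field_derivative)
      show "((\<lambda>x. vt y x) has_real_derivative vtt y x) (at x within cbox 0 t)"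
        if "x \<in> cbox 0 t" "y \<in> cbox l (\<alpha> + \<beta> * s)" for x y
        using that lb by (auto intro: DERIV_subset[OF dtt])
      show "(\<lambda>y. vt y x) integrable_on cbox l (\<alpha> + \<beta> * s)" if "x \<in> cbox 0 t" for x
        using that slice[OF ct _ lb(1)] by (auto intro: integrable_continuous_real)
      show "continuous_on (cbox 0 t \<times> cbox l (\<alpha> + \<beta> * s)) (\<lambda>(x, y). vtt y x)"
        unfolding case_prod_unfold using lb le
        by (intro continuous_on_compose2[OF ctt, of _ "\<lambda>p. (snd p, fst p)", simplified] continuous_intros)
          auto
    qed (use that(1) in auto)
    show "((\<lambda>x. G x \<sigma>) has_real_derivative vt x \<sigma>) (at x within {l..b})"
      if "x \<in> {l..b}" "\<sigma> \<in> {0..t}" for x \<sigma>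
      unfolding G_def using that slice[OF ct _ lb(1)] by (auto intro: integral_has_real_derivative)
  qed (use continuous_on_subset[OF ct box] in auto)
  have "(E has_vector_derivative integral {l + s..b - s} (\<lambda>x. vtt x s - vxx x s) / 2) (at s within {0..t})"
    if s: "s \<in> {0..t}" for s
  proof -
    have in1: "l + 1 * \<sigma> \<in> {l..b}" and in2: "b + (-1) * \<sigma> \<in> {l..b}" if "\<sigma> \<in> {0..t}" for \<sigma>
      using that by (auto simp: l_def b_def)
    have order: "l \<le> l + s" "l + s \<le> b - s" "0 \<le> s" using s by (auto simp: l_def b_def)
    have vtt_int: "(\<lambda>x. vtt x s) integrable_on {l..y}" "(\<lambda>x. vtt x s) integrable_on {l + s..b - s}" for y
      using s lb by (auto intro!: integrable_continuous_real slice[OF ctt])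
    have vtt_add: "integral {l..b - s} (\<lambda>x. vtt x s) - integral {l..l + s} (\<lambda>x. vtt x s)
        = integral {l + s..b - s} (\<lambda>x. vtt x s)"
      using Henstock_Kurzweil_Integration.integral_combine[OF order(1,2) vtt_int(1)] by simp
    have vxx_int: "((\<lambda>x. vxx x s) has_integral vx (b - s) s - vx (l + s) s) {l + s..b - s}"
      using order lb
      by (intro fundamental_theorem_of_calculus)
        (auto simp: has_real_derivative_iff_has_vector_derivative[symmetric] intro: DERIV_subset[OF dxx])
    have eq: "integral {l + s..b - s} (\<lambda>x. vtt x s - vxx x s)
        = integral {l + s..b - s} (\<lambda>x. vtt x s) - (vx (b - s) s - vx (l + s) s)"
      using vxx_int vtt_int(2) by (simp add: integral_diff has_integral_integrable integral_unique)
    have "(E has_real_derivative ((vt (l + 1 * s) s + 1 * vx (l + 1 * s) s)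
         + (vt (b + (-1) * s) s + (-1) * vx (b + (-1) * s) s)
         + (integral {l..b + (-1) * s} (\<lambda>y. vtt y s) + (-1) * vt (b + (-1) * s) s)
         - (integral {l..l + 1 * s} (\<lambda>y. vtt y s) + 1 * vt (l + 1 * s) s)) / 2) (at s within {0..t})"
      using dv[OF s in1] dv[OF s in2] dG[OF s in1] dG[OF s in2]
      unfolding E_def by (intro DERIV_cdivide DERIV_add DERIV_diff) simp_all
    \<comment> \<open>The \<open>vt\<close> terms from the two characteristics cancel against those
      from \<open>G\<close>, and the difference of the \<open>vx\<close> terms is the slice integral
      of \<open>vxx\<close>.\<close>
    also have "((vt (l + 1 * s) s + 1 * vx (l + 1 * s) s)
         + (vt (b + (-1) * s) s + (-1) * vx (b + (-1) * s) s)
         + (integral {l..b + (-1) * s} (\<lambda>y. vtt y s) + (-1) * vt (b + (-1) * s) s)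
         - (integral {l..l + 1 * s} (\<lambda>y. vtt y s) + 1 * vt (l + 1 * s) s)) / 2
        = integral {l + s..b - s} (\<lambda>x. vtt x s - vxx x s) / 2"
      using vtt_add eq by (simp add: field_simps)
    finally show ?thesis by (simp add: has_real_derivative_iff_has_vector_derivative)
  qed
  from fundamental_theorem_of_calculus[OF r(1) this]
  have "((\<lambda>s. integral {l + s..b - s} (\<lambda>x. vtt x s - vxx x s) / 2) has_integral E t - E 0) {0..t}" .
  moreover have "E t - E 0 = v r t - (v (r - t) 0 + v (r + t) 0) / 2 - integral {r - t..r + t} (\<lambda>x. vt x 0) / 2"
    using G_add[of l b 0] lb by (simp add: E_def field_simps l_def b_def)
  ultimately show ?thesis by (simp add: l_def b_def)
qed

text \<open>The domain of integration moves with \<open>s\<close>. The affine substitution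
  \<open>y\<close> carries it to the fixed interval from 0 to 1, also when it degenerates to a point
  at \<open>s = t\<close>; what remains is an integral with a parameter.\<close>

lemma continuous_on_slice_integral:
  fixes h :: "real \<Rightarrow> real \<Rightarrow> real"
  assumes h: "continuous_on ({0<..} \<times> {0..}) (\<lambda>(x, t). h x t)" and r: "0 \<le> t" "t < r"
  shows "continuous_on {0..t} (\<lambda>s. integral {r - t + s..r + t - s} (\<lambda>x. h x s))"
proof -
  define y where "y s \<theta> = r - t + s + 2 * (t - s) * \<theta>" for s \<theta> :: real
  have y_bounds: "r - t + s \<le> y s \<theta>" "y s \<theta> \<le> r + t - s" if "\<theta> \<in> {0..1}" "s \<in> {0..t}" for s \<theta>
    using that mult_left_le[of \<theta> "2 * (t - s)"] by (auto simp: y_def)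
  have "integral {r - t + s..r + t - s} (\<lambda>x. h x s) = integral (cbox 0 1) (\<lambda>\<theta>. 2 * (t - s) * h (y s \<theta>) s)"
    if s: "s \<in> {0..t}" for s
  proof -
    have "((\<lambda>\<theta>. (2 * (t - s)) *\<^sub>R h (y s \<theta>) s) has_integral integral {y s 0..y s 1} (\<lambda>x. h x s)) {0..1}"
    proof (rule has_integral_substitution)
      show "y s ` {0..1} \<subseteq> {r - t + s..r + t - s}" using y_bounds s by auto
      show "continuous_on {r - t + s..r + t - s} (\<lambda>x. h x s)"
        by (rule continuous_on_compose2[OF h, of _ "\<lambda>x. (x, s)", simplified])
          (use s r in \<open>auto intro!: continuous_intros\<close>)
    qed (use s in \<open>auto simp: y_def intro!: derivative_eq_intros\<close>)
    then have "((\<lambda>\<theta>. 2 * (t - s) * h (y s \<theta>) s) has_integral integral {y s 0..y s 1} (\<lambda>x. h x s)) (cbox 0 1)"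
      by (simp only: real_scaleR_def box_real)
    moreover have "y s 0 = r - t + s" "y s 1 = r + t - s" by (simp_all add: y_def)
    ultimately show ?thesis by (metis integral_unique)
  qed
  moreover have "continuous_on {0..t} (\<lambda>s. integral (cbox 0 1) (\<lambda>\<theta>. 2 * (t - s) * h (y s \<theta>) s))"
  proof (rule integral_continuous_on_param)
    have "continuous_on ({0..t} \<times> {0..1}) (\<lambda>p. (\<lambda>(x, t). h x t) (y (fst p) (snd p), fst p))"
    proof (rule continuous_on_compose2[OF h])
      show "continuous_on ({0..t} \<times> {0..1}) (\<lambda>p. (y (fst p) (snd p), fst p))"
        unfolding y_def by (intro continuous_intros)
      have "0 < y s \<theta>" if "\<theta> \<in> {0..1}" "s \<in> {0..t}" for s \<theta>
        using y_bounds(1)[OF that] that r by auto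
      then show "(\<lambda>p. (y (fst p) (snd p), fst p)) ` ({0..t} \<times> {0..1}) \<subseteq> {0<..} \<times> {0..}"
        by auto
    qed
    then show "continuous_on ({0..t} \<times> cbox 0 1) (\<lambda>(s, \<theta>). 2 * (t - s) * h (y s \<theta>) s)"
      by (auto simp: case_prod_unfold intro!: continuous_intros)
  qed
  ultimately show ?thesis
    by (smt (verit, best) continuous_on_eq)
qed

section \<open>One-sided bounds for the wave equation with inverse-square potential\<close>

text \<open>To be applied with \<open>v = r^a u\<close>, \<open>h = r^a F(u)\<close> and
  \<open>c = a (a - 1)\<close>. The sign of \<open>c\<close> means that the potential can only lower
  the solution where \<open>v \<ge> 0\<close>.\<close>

locale wave_with_potential =
  fixes v vx vt vxx vtt h :: "real \<Rightarrow> real \<Rightarrow> real" and c :: real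
  assumes dx: "\<And>x t. x > 0 \<Longrightarrow> t \<ge> 0 \<Longrightarrow> ((\<lambda>x. v x t) has_real_derivative vx x t) (at x)"
    and dxx: "\<And>x t. x > 0 \<Longrightarrow> t \<ge> 0 \<Longrightarrow> ((\<lambda>x. vx x t) has_real_derivative vxx x t) (at x)"
    and dt: "\<And>x t. x > 0 \<Longrightarrow> t \<ge> 0 \<Longrightarrow> ((\<lambda>t. v x t) has_real_derivative vt x t) (at t within {0..})"
    and dtt: "\<And>x t. x > 0 \<Longrightarrow> t \<ge> 0 \<Longrightarrow> ((\<lambda>t. vt x t) has_real_derivative vtt x t) (at t within {0..})"
    and cx: "continuous_on ({0<..} \<times> {0..}) (\<lambda>(x, t). vx x t)"
    and ct: "continuous_on ({0<..} \<times> {0..}) (\<lambda>(x, t). vt x t)"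
    and ctt: "continuous_on ({0<..} \<times> {0..}) (\<lambda>(x, t). vtt x t)"
    and ch: "continuous_on ({0<..} \<times> {0..}) (\<lambda>(x, t). h x t)"
    and wave: "\<And>x t. x > 0 \<Longrightarrow> t \<ge> 0 \<Longrightarrow> vtt x t - vxx x t = h x t - c * v x t / x\<^sup>2"
    and c_nonneg: "c \<ge> 0"
begin

lemma slices:
  assumes "0 \<le> s" "0 < a"
  shows "continuous_on {a..b} (\<lambda>x. v x s)" "continuous_on {a..b} (\<lambda>x. vt x s)"
    "continuous_on {a..b} (\<lambda>x. h x s)"
proof -
  show "continuous_on {a..b} (\<lambda>x. v x s)"
    using assms by (intro DERIV_continuous_on[where D = "\<lambda>x. vx x s"] DERIV_subset[OF dx]) auto
  have "continuous_on {a..b} (\<lambda>x. w x s)"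
    if "continuous_on ({0<..} \<times> {0..}) (\<lambda>(x, t). w x t)" for w :: "real \<Rightarrow> real \<Rightarrow> real"
    by (rule continuous_on_compose2[OF that, of _ "\<lambda>x. (x, s)", simplified])
      (use assms in \<open>auto intro!: continuous_intros\<close>)
  from this[OF ct] this[OF ch] show "continuous_on {a..b} (\<lambda>x. vt x s)" "continuous_on {a..b} (\<lambda>x. h x s)" .
qed

lemma duhamel:
  assumes "0 \<le> t" "t < r"
  shows "((\<lambda>s. integral {r - t + s..r + t - s} (\<lambda>x. h x s - c * v x s / x\<^sup>2) / 2) has_integral
           v r t - (v (r - t) 0 + v (r + t) 0) / 2 - integral {r - t..r + t} (\<lambda>x. vt x 0) / 2) {0..t}"
proof (rule has_integral_cong[THEN iffD1, OF _ dalembert[OF dx dxx dt dtt cx ct ctt assms]])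
  show "integral {r - t + s..r + t - s} (\<lambda>x. vtt x s - vxx x s) / 2
      = integral {r - t + s..r + t - s} (\<lambda>x. h x s - c * v x s / x\<^sup>2) / 2" if "s \<in> {0..t}" for s
    using that assms by (intro arg_cong[where f = "\<lambda>y. y / 2"] integral_cong wave) auto
qed

text \<open>This is the solution of the wave equation with source \<open>h\<close> and zero data:
  half the integral of \<open>h\<close> over the backward triangle with apex
  \<open>(r, t)\<close>.\<close>

definition forcing :: "real \<Rightarrow> real \<Rightarrow> real" where
  "forcing r t = integral {0..t} (\<lambda>s. integral {r - t + s..r + t - s} (\<lambda>x. h x s) / 2)"

lemma forcing_integrable:
  assumes "0 \<le> t" "t < r" "0 \<le> a" "b \<le> t"
  shows "(\<lambda>s. integral {r - t + s..r + t - s} (\<lambda>x. h x s) / 2) integrable_on {a..b}"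
  using continuous_on_slice_integral[OF ch assms(1,2)] assms(3,4)
  by (intro integrable_continuous_real continuous_intros) (auto elim!: continuous_on_subset)

lemma slice_integrable:
  assumes "0 \<le> s" "0 < a"
  shows "(\<lambda>x. h x s - c * v x s / x\<^sup>2) integrable_on {a..b}" "(\<lambda>x. h x s) integrable_on {a..b}"
     "(\<lambda>x. v x s) integrable_on {a..b}" "(\<lambda>x. vt x s) integrable_on {a..b}"
    "(\<lambda>x. c * v x s / x\<^sup>2) integrable_on {a..b}"
  using assms by (auto intro!: integrable_continuous_real continuous_intros slices)

text \<open>The signs of \<open>v\<close> and \<open>h\<close> are required strictly below the apex
  only, so that the bounds can be applied at a point where positivity of \<open>v\<close> is still
  to be shown.\<close>

context
  fixes r t :: real
  assumes t: "0 \<le> t" "t < r"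
    and v_nonneg: "\<And>x s. 0 \<le> s \<Longrightarrow> s < t \<Longrightarrow> r - t + s \<le> x \<Longrightarrow> x \<le> r + t - s \<Longrightarrow> 0 \<le> v x s"
    and h_nonneg: "\<And>x s. 0 \<le> s \<Longrightarrow> s < t \<Longrightarrow> r - t + s \<le> x \<Longrightarrow> x \<le> r + t - s \<Longrightarrow> 0 \<le> h x s"
    and vt_nonneg: "\<And>x. r - t \<le> x \<Longrightarrow> x \<le> r + t \<Longrightarrow> 0 \<le> vt x 0"
begin

lemma forcing_slice_nonneg:
  assumes "0 \<le> s" "s \<le> t"
  shows "0 \<le> integral {r - t + s..r + t - s} (\<lambda>x. h x s)"
proof (cases "s = t")
  case False
  then show ?thesis using assms t
    by (intro integral_nonneg slice_integrable h_nonneg) auto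
qed simp

lemma upper_bound:
  assumes s: "0 \<le> s" "s < t" and x: "r - t + s \<le> x" "x \<le> r + t - s"
  shows "v x s \<le> (v (x - s) 0 + v (x + s) 0) / 2 + (integral {r - t..r + t} (\<lambda>x. vt x 0) / 2 + forcing r t)"
proof -
  have "v x s - (v (x - s) 0 + v (x + s) 0) / 2 - integral {x - s..x + s} (\<lambda>x. vt x 0) / 2
      \<le> integral {0..s} (\<lambda>s. integral {r - t + s..r + t - s} (\<lambda>x. h x s) / 2)"
  proof (rule has_integral_le[OF duhamel integrable_integral[OF forcing_integrable]])
    fix \<sigma> assume \<sigma>: "\<sigma> \<in> {0..s}"
    have "integral {x - s + \<sigma>..x + s - \<sigma>} (\<lambda>x. h x \<sigma> - c * v x \<sigma> / x\<^sup>2)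
        \<le> integral {x - s + \<sigma>..x + s - \<sigma>} (\<lambda>x. h x \<sigma>)"
      using \<sigma> s x t c_nonneg
      by (intro integral_le slice_integrable) (auto intro!: divide_nonneg_nonneg mult_nonneg_nonneg v_nonneg)
    also have "\<dots> \<le> integral {r - t + \<sigma>..r + t - \<sigma>} (\<lambda>x. h x \<sigma>)"
      using \<sigma> s x t by (intro integral_subset_le slice_integrable) (auto intro!: h_nonneg)
    finally show "integral {x - s + \<sigma>..x + s - \<sigma>} (\<lambda>x. h x \<sigma> - c * v x \<sigma> / x\<^sup>2) / 2
        \<le> integral {r - t + \<sigma>..r + t - \<sigma>} (\<lambda>x. h x \<sigma>) / 2" by simp
  qed (use s x t in auto)
  also have "\<dots> \<le> forcing r t"
    unfolding forcing_def using s t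
    by (intro integral_subset_le forcing_integrable) (auto intro!: forcing_slice_nonneg)
  finally have "v x s - (v (x - s) 0 + v (x + s) 0) / 2 - integral {x - s..x + s} (\<lambda>x. vt x 0) / 2 \<le> forcing r t" .
  moreover have "integral {x - s..x + s} (\<lambda>x. vt x 0) \<le> integral {r - t..r + t} (\<lambda>x. vt x 0)"
    using s x t by (intro integral_subset_le slice_integrable) (auto intro!: vt_nonneg)
  ultimately show ?thesis by simp
qed

lemma forcing_nonneg: "0 \<le> forcing r t"
  unfolding forcing_def using forcing_slice_nonneg t by (intro integral_nonneg forcing_integrable) auto

text \<open>
  The potential term is bounded with the help of \<open>upper_bound\<close>. The contribution of the initial
  position to that bound is paid for by the initial velocity, since \<open>2 v \<le> r v\<^sub>t\<close> at time 0.
\<close>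

lemma lower_bound:
  assumes small: "4 * t \<le> r - t" "2 * c * t \<le> r - t"
    and data_nonneg: "\<And>x. r - t \<le> x \<Longrightarrow> x \<le> r + t \<Longrightarrow> 0 \<le> v x 0"
    and data: "\<And>x. r - t \<le> x \<Longrightarrow> x \<le> r + t \<Longrightarrow> 2 * v x 0 \<le> x * vt x 0"
  shows "(v (r - t) 0 + v (r + t) 0) / 2 + integral {r - t..r + t} (\<lambda>x. vt x 0) / 4 + forcing r t / 2 \<le> v r t"
proof -
  define l where "l = r - t"
  define b where "b = r + t"
  \<comment> \<open>\<open>K\<close> is the part of \<open>upper_bound\<close> common to the whole
    triangle. \<open>N\<close> will bound the potential integral over each slice: the two shifted
    initial positions contribute at most \<open>Y\<close> on average, and the slice has length at
    most \<open>2 * t\<close>.\<close>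
  define K where "K = integral {l..b} (\<lambda>x. vt x 0) / 2 + forcing r t"
  define Y where "Y = integral {l..b} (\<lambda>x. v x 0)"
  define N where "N = c / l\<^sup>2 * (Y + 2 * t * K)"
  have lb: "0 < l" "l \<le> b" "b = l + 2 * t" using t by (auto simp: l_def b_def)
  have "0 \<le> integral {l..b} (\<lambda>x. vt x 0)"
    using lb vt_nonneg by (intro integral_nonneg slice_integrable) (auto simp: l_def b_def)
  then have K_nonneg: "0 \<le> K" using forcing_nonneg by (simp add: K_def)
  have Y_nonneg: "0 \<le> Y"
    unfolding Y_def using lb data_nonneg by (intro integral_nonneg slice_integrable) (auto simp: l_def b_def)
  have "Y \<le> integral {l..b} (\<lambda>x. b / 2 * vt x 0)"
    unfolding Y_def
  proof (rule integral_le)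
    fix x assume x: "x \<in> {l..b}"
    then have "x * vt x 0 \<le> b * vt x 0" using vt_nonneg by (intro mult_right_mono) (auto simp: l_def b_def)
    with data[of x] x show "v x 0 \<le> b / 2 * vt x 0" by (auto simp: l_def b_def)
  qed (use lb slice_integrable[of 0 l b] in \<open>auto intro!: integrable_on_cmult_left\<close>)
  also have "\<dots> = b * (integral {l..b} (\<lambda>x. vt x 0) / 2)" by simp
  also have "\<dots> \<le> b * K" using lb forcing_nonneg unfolding K_def by (intro mult_left_mono) auto
  finally have Y_le: "Y \<le> b * K" .
  have N_nonneg: "0 \<le> N" unfolding N_def using c_nonneg Y_nonneg K_nonneg t by simp
  \<comment> \<open>With \<open>Y \<le> b * K\<close> and \<open>b = l + 2 * t\<close>, the bound
    \<open>t * N \<le> K\<close> comes down to \<open>(l + 4 * t) * t * c \<le> l\<^sup>2\<close>.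
    Both smallness conditions enter here.\<close>
  have "(l + 4 * t) * (t * c) \<le> (2 * l) * (t * c)"
    using small(1) t c_nonneg unfolding l_def by (intro mult_right_mono) auto
  also have "\<dots> \<le> l * l" using mult_left_mono[OF small(2), of l] lb by (simp add: l_def algebra_simps)
  finally have ineq: "(l + 4 * t) * t * c \<le> l\<^sup>2" by (simp add: power2_eq_square mult.assoc)
  have "t * N \<le> t * (c / l\<^sup>2 * (b * K + 2 * t * K))"
    unfolding N_def using Y_le t c_nonneg by (intro mult_left_mono) auto
  also have "\<dots> = ((l + 4 * t) * t * c) / l\<^sup>2 * K" by (simp add: lb(3) algebra_simps add_divide_distrib)
  also have "\<dots> \<le> 1 * K" using ineq K_nonneg lb by (intro mult_right_mono) auto
  finally have tN: "t * N \<le> K" by simp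

  have slice: "(integral {l + s..b - s} (\<lambda>x. h x s) - N) / 2
      \<le> integral {l + s..b - s} (\<lambda>x. h x s - c * v x s / x\<^sup>2) / 2" if s: "s \<in> {0..t}" for s
  proof (cases "s = t")
    case True
    then show ?thesis using N_nonneg by (simp add: l_def b_def)
  next
    case False
    with s have s: "0 \<le> s" "s < t" by auto
    \<comment> \<open>The sign of the shift is left open to cover both characteristics; the shifted
      slice stays inside the base because \<open>\<bar>\<sigma>\<bar> \<le> s\<close>.\<close>
    have shift: "(\<lambda>x. v (x + \<sigma>) 0) integrable_on {l + s..b - s}"
      "integral {l + s..b - s} (\<lambda>x. v (x + \<sigma>) 0) \<le> Y" if "\<bar>\<sigma>\<bar> \<le> s" for \<sigma>
    proof -
      have "continuous_on {l + s + \<sigma>..b - s + \<sigma>} (\<lambda>x. v x 0)" using that lb s by (intro slices) auto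
      from integral_shift[OF this] have "integral {l + s..b - s} (\<lambda>x. v (x + \<sigma>) 0)
          = integral {l + s + \<sigma>..b - s + \<sigma>} (\<lambda>x. v x 0)" by (simp add: o_def)
      also have "\<dots> \<le> Y"
        unfolding Y_def using that lb s data_nonneg
        by (intro integral_subset_le slice_integrable) (auto simp: l_def b_def)
      finally show "integral {l + s..b - s} (\<lambda>x. v (x + \<sigma>) 0) \<le> Y" .
      show "(\<lambda>x. v (x + \<sigma>) 0) integrable_on {l + s..b - s}"
        by (intro integrable_continuous_real continuous_on_compose2[OF slices(1)[of 0 l b]] continuous_intros)
          (use that lb s in auto)
    qed
    have bound_integrable: "(\<lambda>x. v (x + - s) 0 / 2 + v (x + s) 0 / 2 + K) integrable_on {l + s..b - s}"
      using shift(1)[of s] shift(1)[of "- s"] s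
      by (intro integrable_add integrable_on_divide) auto
    have "integral {l + s..b - s} (\<lambda>x. c * v x s / x\<^sup>2) \<le> integral {l + s..b - s} (\<lambda>x. c / l\<^sup>2 * (v (x + - s) 0 / 2 + v (x + s) 0 / 2 + K))"
    proof (rule integral_le)
      fix x assume x: "x \<in> {l + s..b - s}"
      have v: "0 \<le> v x s" "v x s \<le> v (x + - s) 0 / 2 + v (x + s) 0 / 2 + K"
        using upper_bound[of s x] v_nonneg[of s x] x s by (auto simp: K_def l_def b_def add_divide_distrib)
      have "c * v x s / x\<^sup>2 \<le> c * v x s / l\<^sup>2"
        using x s lb v c_nonneg by (intro divide_left_mono power_mono mult_nonneg_nonneg mult_pos_pos) auto
      also have "\<dots> = c / l\<^sup>2 * v x s" by simp
      also have "\<dots> \<le> c / l\<^sup>2 * (v (x + - s) 0 / 2 + v (x + s) 0 / 2 + K)"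
        using v c_nonneg by (intro mult_left_mono) auto
      finally show "c * v x s / x\<^sup>2 \<le> c / l\<^sup>2 * (v (x + - s) 0 / 2 + v (x + s) 0 / 2 + K)" .
    qed (rule slice_integrable integrable_on_mult_right[OF bound_integrable]; use s lb in simp)+
    also have "\<dots> = c / l\<^sup>2 * (integral {l + s..b - s} (\<lambda>x. v (x + - s) 0) / 2
        + integral {l + s..b - s} (\<lambda>x. v (x + s) 0) / 2 + (b - s - (l + s)) * K)"
      using shift(1)[of s] shift(1)[of "- s"] s
      by (subst integral_mult_right, subst integral_add integral_add)
        (auto simp: integral_add integrable_add l_def b_def intro!: integrable_on_divide integrable_add)
    also have "\<dots> \<le> N"
      unfolding N_def
      using shift(2)[of s] shift(2)[of "- s"] s c_nonneg K_nonneg lb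
      by (intro mult_left_mono add_mono mult_right_mono) auto
    finally have "integral {l + s..b - s} (\<lambda>x. c * v x s / x\<^sup>2) \<le> N" .
    then show ?thesis using s lb slice_integrable[of s "l + s" "b - s"]
      by (simp add: integral_diff)
  qed
  \<comment> \<open>Over the whole time the potential costs at most
    \<open>t * N / 2 \<le> K / 2\<close>, so half of \<open>K\<close> survives.\<close>
  have "integral {0..t} (\<lambda>s. (integral {l + s..b - s} (\<lambda>x. h x s) - N) / 2)
      \<le> v r t - (v l 0 + v b 0) / 2 - integral {l..b} (\<lambda>x. vt x 0) / 2"
    using slice duhamel[OF t] forcing_integrable[OF t, of 0 t] t unfolding l_def b_def diff_divide_distrib
    by (intro has_integral_le[OF integrable_integral]) (auto intro!: integrable_diff)
  also have "integral {0..t} (\<lambda>s. (integral {l + s..b - s} (\<lambda>x. h x s) - N) / 2) = forcing r t - t * N / 2"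
    using forcing_integrable[OF t, of 0 t] t
    unfolding forcing_def l_def b_def diff_divide_distrib by (subst integral_diff) auto
  finally show ?thesis using tN unfolding K_def l_def b_def by (simp add: field_simps)
qed

text \<open>Only slices at times between \<open>a\<close> and \<open>b\<close> are kept; their
  half-length \<open>t - s\<close> is at least \<open>t - b\<close>.\<close>

lemma forcing_lower_bound:
  assumes ab: "0 \<le> a" "a \<le> b" "b \<le> t" and \<mu>: "0 \<le> \<mu>"
    and h_ge: "\<And>x s. a \<le> s \<Longrightarrow> s \<le> b \<Longrightarrow> r - t + s \<le> x \<Longrightarrow> x \<le> r + t - s \<Longrightarrow> \<mu> \<le> h x s"
  shows "(b - a) * (t - b) * \<mu> \<le> forcing r t"
proof -
  have "(b - a) * (t - b) * \<mu> = integral {a..b} (\<lambda>s. (t - b) * \<mu>)" using ab by simp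
  also have "\<dots> \<le> integral {a..b} (\<lambda>s. integral {r - t + s..r + t - s} (\<lambda>x. h x s) / 2)"
  proof (rule integral_le)
    fix s assume s: "s \<in> {a..b}"
    have "2 * ((t - b) * \<mu>) \<le> (r + t - s - (r - t + s)) * \<mu>"
      using mult_right_mono[of "t - b" "t - s" \<mu>] s \<mu> by (simp add: algebra_simps)
    also have "\<dots> = integral {r - t + s..r + t - s} (\<lambda>x. \<mu>)" using s ab by simp
    also have "\<dots> \<le> integral {r - t + s..r + t - s} (\<lambda>x. h x s)"
      using s ab t h_ge by (intro integral_le slice_integrable) auto
    finally show "(t - b) * \<mu> \<le> integral {r - t + s..r + t - s} (\<lambda>x. h x s) / 2" by simp
  qed (use forcing_integrable[OF t ab(1,3)] in auto)
  also have "\<dots> \<le> forcing r t"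
    unfolding forcing_def using ab t
    by (intro integral_subset_le forcing_integrable) (auto intro!: forcing_slice_nonneg)
  finally show ?thesis .
qed

end

end

section \<open>Positivity and amplification on a trapezoid\<close>

text \<open>\<open>\<Lambda>\<close> is the radial scale and \<open>T\<close> the time available;
  the data are controlled on the base from \<open>\<Lambda>\<close> to \<open>3 * \<Lambda>\<close>.
  Since \<open>r - t \<ge> \<Lambda>\<close> throughout \<open>region\<close>, the smallness of
  \<open>T\<close> against \<open>\<Lambda>\<close> yields the smallness conditions of
  \<open>lower_bound\<close> at each of its points.\<close>

locale radial_blowup =
  wave_with_potential "\<lambda>x t. x powr a * u x t" vx vt vxx vtt "\<lambda>x t. x powr a * F (u x t)" c
  for u vx vt vxx vtt :: "real \<Rightarrow> real \<Rightarrow> real" and F :: "real \<Rightarrow> real" and a c :: real +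
  fixes g :: "real \<Rightarrow> real" and A p \<Lambda> T :: real
  assumes u_cont: "continuous_on ({0<..} \<times> {0..}) (\<lambda>(x, t). u x t)"
    and F_ge: "\<And>s. s \<ge> 0 \<Longrightarrow> F s \<ge> A * s powr p"
    and A: "A > 0" and p: "p > 1" and a: "a \<ge> 0"
    and \<Lambda>: "\<Lambda> > 0" and T: "T > 0" "4 * T \<le> \<Lambda>" "2 * c * T \<le> \<Lambda>"
    and vt_0: "\<And>x. \<Lambda> \<le> x \<Longrightarrow> x \<le> 3 * \<Lambda> \<Longrightarrow> vt x 0 = x powr a * g x"
    and u_0: "\<And>x. \<Lambda> \<le> x \<Longrightarrow> x \<le> 3 * \<Lambda> \<Longrightarrow> 0 < u x 0"
    and g_nonneg: "\<And>x. \<Lambda> \<le> x \<Longrightarrow> x \<le> 3 * \<Lambda> \<Longrightarrow> 0 \<le> g x"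
    and u_0_le: "\<And>x. \<Lambda> \<le> x \<Longrightarrow> x \<le> 3 * \<Lambda> \<Longrightarrow> 2 * u x 0 \<le> x * g x"
begin

text \<open>A trapezoid bounded at the sides by characteristics, hence containing the backward
  triangle below each of its points.\<close>

definition region :: "(real \<times> real) set" where
  "region = {(r, t). 0 \<le> t \<and> t \<le> T \<and> \<Lambda> + t \<le> r \<and> r \<le> 3 * \<Lambda> - t}"

lemma region_triangle:
  assumes "(r, t) \<in> region" "0 \<le> s" "s \<le> t" "r - t + s \<le> x" "x \<le> r + t - s"
  shows "(x, s) \<in> region"
  using assms by (auto simp: region_def)

lemma F_nonneg: "0 \<le> F s" if "0 \<le> s"
  using F_ge[OF that] A by (meson mult_nonneg_nonneg less_imp_le order_trans powr_ge_zero)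

text \<open>The three conclusions rest on the same sign conditions and are proved together.
  Positivity is assumed before time \<open>t\<close> only, as the argument at a first zero
  demands.\<close>

lemma lower_bound_if_pos:
  assumes rt: "(r, t) \<in> region"
    and pos: "\<forall>(x, s) \<in> region. s < t \<longrightarrow> 0 < u x s"
  shows "((r - t) powr a * u (r - t) 0 + (r + t) powr a * u (r + t) 0) / 2
      + integral {r - t..r + t} (\<lambda>x. vt x 0) / 4 + forcing r t / 2 \<le> r powr a * u r t" (is ?bound)
    and "0 \<le> forcing r t"
    and "\<And>\<alpha> \<beta> \<mu>. 0 \<le> \<alpha> \<Longrightarrow> \<alpha> \<le> \<beta> \<Longrightarrow> \<beta> \<le> t \<Longrightarrow> 0 \<le> \<mu> \<Longrightarrow>
      (\<And>x s. \<alpha> \<le> s \<Longrightarrow> s \<le> \<beta> \<Longrightarrow> r - t + s \<le> x \<Longrightarrow> x \<le> r + t - s \<Longrightarrow> \<mu> \<le> x powr a * F (u x s)) \<Longrightarrow>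
      (\<beta> - \<alpha>) * (t - \<beta>) * \<mu> \<le> forcing r t"
proof -
  have t: "0 \<le> t" "t < r" "\<Lambda> \<le> r - t" "r + t \<le> 3 * \<Lambda>" "t \<le> T"
    using rt \<Lambda> by (auto simp: region_def)
  have v: "0 \<le> x powr a * u x s" "0 \<le> x powr a * F (u x s)"
    if "0 \<le> s" "s < t" "r - t + s \<le> x" "x \<le> r + t - s" for x s
    using pos region_triangle[OF rt, of s x] that F_nonneg[of "u x s"] by (force intro: mult_nonneg_nonneg)+
  have vt: "0 \<le> vt x 0" if "r - t \<le> x" "x \<le> r + t" for x
    using that t by (simp add: vt_0 g_nonneg)
  show ?bound
  proof (rule lower_bound[OF t(1,2) v vt])
    show "4 * t \<le> r - t" using t T by linarith
    have "c * t \<le> c * T" using t(5) c_nonneg by (rule mult_left_mono)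
    then show "2 * c * t \<le> r - t" using t T by linarith
    fix x assume x: "r - t \<le> x" "x \<le> r + t"
    then show "0 \<le> x powr a * u x 0" using u_0[of x] t by (intro mult_nonneg_nonneg) auto
    show "2 * (x powr a * u x 0) \<le> x * vt x 0"
      using mult_left_mono[OF u_0_le[of x], of "x powr a"] vt_0[of x] x t by (simp add: algebra_simps)
  qed
  show "0 \<le> forcing r t" by (rule forcing_nonneg[OF t(1,2) v vt])
  show "(\<beta> - \<alpha>) * (t - \<beta>) * \<mu> \<le> forcing r t"
    if "0 \<le> \<alpha>" "\<alpha> \<le> \<beta>" "\<beta> \<le> t" "0 \<le> \<mu>"
      "\<And>x s. \<alpha> \<le> s \<Longrightarrow> s \<le> \<beta> \<Longrightarrow> r - t + s \<le> x \<Longrightarrow> x \<le> r + t - s \<Longrightarrow> \<mu> \<le> x powr a * F (u x s)"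
    for \<alpha> \<beta> \<mu>
    by (rule forcing_lower_bound) (use that v vt t in auto)
qed

lemma vt_integral_nonneg: "0 \<le> integral {r - t..r + t} (\<lambda>x. vt x 0)" if "(r, t) \<in> region"
  using that \<Lambda> by (intro integral_nonneg slice_integrable) (auto simp: region_def vt_0 g_nonneg)

text \<open>At a point of \<open>region\<close> where \<open>u \<le> 0\<close> at the earliest
  possible time, \<open>lower_bound_if_pos\<close> applies and bounds \<open>u\<close> from below by
  the positive initial position at the two feet of the triangle.\<close>

lemma u_pos:
  assumes "(r, t) \<in> region"
  shows "0 < u r t"
proof (rule ccontr)
  assume neg: "\<not> 0 < u r t"
  \<comment> \<open>Compactness ensures that the earliest time with \<open>u \<le> 0\<close> is
    attained.\<close>
  have "region = cbox (0, 0) (3 * \<Lambda>, T) \<inter> {q. \<Lambda> + snd q \<le> fst q} \<inter> {q. fst q \<le> 3 * \<Lambda> - snd q}"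
    using \<Lambda> by (auto simp: region_def mem_box)
  then have compact: "compact region"
    by (auto intro!: compact_Int_closed closed_Collect_le continuous_intros)
  have "continuous_on region (\<lambda>(x, t). u x t)"
    using u_cont by (rule continuous_on_subset) (use \<Lambda> in \<open>auto simp: region_def\<close>)
  then have "closed (region \<inter> (\<lambda>(x, t). u x t) -` {..0})"
    using compact by (intro continuous_closed_preimage) (auto intro: compact_imp_closed)
  with compact have "compact (region \<inter> (region \<inter> (\<lambda>(x, t). u x t) -` {..0}))"
    by (rule compact_Int_closed)
  moreover have "region \<inter> (region \<inter> (\<lambda>(x, t). u x t) -` {..0}) \<noteq> {}" using assms neg by auto
  ultimately obtain q where "q \<in> region \<inter> (region \<inter> (\<lambda>(x, t). u x t) -` {..0})"
    and "\<forall>q' \<in> region \<inter> (region \<inter> (\<lambda>(x, t). u x t) -` {..0}). snd q \<le> snd q'"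
    using continuous_attains_inf[of _ snd] continuous_on_snd[OF continuous_on_id] by blast
  then have q: "q \<in> region" "(\<lambda>(x, t). u x t) q \<le> 0"
    and min: "\<And>q'. q' \<in> region \<Longrightarrow> (\<lambda>(x, t). u x t) q' \<le> 0 \<Longrightarrow> snd q \<le> snd q'"
    by auto
  obtain x s where xs: "q = (x, s)" by force
  have region_xs: "(x, s) \<in> region" using q xs by simp
  have pos: "\<forall>(y, \<sigma>) \<in> region. \<sigma> < s \<longrightarrow> 0 < u y \<sigma>"
    using min xs by fastforce
  have "0 < ((x - s) powr a * u (x - s) 0 + (x + s) powr a * u (x + s) 0) / 2"
    using region_xs \<Lambda> u_0[of "x - s"] u_0[of "x + s"] by (auto simp: region_def intro!: add_pos_pos)
  also have "\<dots> \<le> x powr a * u x s"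
    using lower_bound_if_pos(1,2)[OF region_xs pos] vt_integral_nonneg[OF region_xs] by linarith
  finally show False using q xs by (simp add: zero_less_mult_iff)
qed

lemma u_pos_all: "\<forall>(x, s) \<in> region. s < t \<longrightarrow> 0 < u x s"
  using u_pos by auto

lemma lower_bounds:
  assumes rt: "(r, t) \<in> region"
  shows "(r - t) powr a * u (r - t) 0 / 2 \<le> r powr a * u r t"
    and "integral {r - t..r + t} (\<lambda>x. vt x 0) / 4 \<le> r powr a * u r t"
    and "forcing r t / 2 \<le> r powr a * u r t"
proof -
  have aux: "x / 2 \<le> w" "i / 4 \<le> w" "k / 2 \<le> w"
    if "0 \<le> x" "0 \<le> y" "0 \<le> i" "0 \<le> k" "(x + y) / 2 + i / 4 + k / 2 \<le> w" for x y i k w :: real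
    using that by (simp_all add: field_simps)
  have "0 \<le> x powr a * u x 0" if "x = r - t \<or> x = r + t" for x
    using that rt u_0[of x] by (intro mult_nonneg_nonneg) (auto simp: region_def)
  from aux[OF this this vt_integral_nonneg[OF rt]
      lower_bound_if_pos(2,1)[OF rt u_pos_all]]
  show "(r - t) powr a * u (r - t) 0 / 2 \<le> r powr a * u r t"
    "integral {r - t..r + t} (\<lambda>x. vt x 0) / 4 \<le> r powr a * u r t"
    "forcing r t / 2 \<le> r powr a * u r t" by auto
qed

text \<open>Since \<open>t \<le> T \<le> \<Lambda> / 4\<close>, the radius at most doubles between
  the left foot \<open>r - t\<close> of the triangle and its apex.\<close>

lemma radius_powr: "r powr a \<le> 2 powr a * (r - t) powr a" if "(r, t) \<in> region"
proof -
  have "r \<le> 2 * (r - t)" "0 < r - t" using that T \<Lambda> by (auto simp: region_def)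
  then have "r powr a \<le> (2 * (r - t)) powr a" using a that T \<Lambda> by (intro powr_mono2) (auto simp: region_def)
  then show ?thesis using \<open>0 < r - t\<close> powr_mult[of 2 "r - t" a] by simp
qed

text \<open>Bounds are first obtained with the weight at the left foot, where it is smallest on the
  triangle; here the weights are removed at the cost of \<open>2 powr a\<close>.\<close>

lemma u_ge_divide:
  assumes rt: "(r, t) \<in> region" and "(r - t) powr a * M \<le> r powr a * u r t"
  shows "M / 2 powr a \<le> u r t"
proof -
  have l: "0 < r - t" using rt \<Lambda> by (auto simp: region_def)
  have "r powr a * u r t \<le> 2 powr a * (r - t) powr a * u r t"
    using radius_powr[OF rt] u_pos[OF rt] by (intro mult_right_mono) auto
  with assms(2) have "(r - t) powr a * M \<le> (r - t) powr a * (2 powr a * u r t)" by (simp add: algebra_simps)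
  then show ?thesis using l by (simp add: field_simps)
qed

lemma initial_bound_position:
  assumes rt: "(r, t) \<in> region" and M: "\<And>x. \<Lambda> \<le> x \<Longrightarrow> x \<le> 3 * \<Lambda> \<Longrightarrow> M \<le> u x 0"
  shows "M / 2 / 2 powr a \<le> u r t"
proof (rule u_ge_divide[OF rt])
  have "\<Lambda> \<le> r - t" "r - t \<le> 3 * \<Lambda>" "\<Lambda> \<le> r + t" "r + t \<le> 3 * \<Lambda>" using rt by (auto simp: region_def)
  then have "(r - t) powr a * M \<le> (r - t) powr a * u (r - t) 0"
    using M by (intro mult_left_mono) auto
  then show "(r - t) powr a * (M / 2) \<le> r powr a * u r t"
    using lower_bounds(1)[OF rt] by simp
qed

lemma initial_bound_velocity:
  assumes rt: "(r, t) \<in> region" and M: "\<And>x. \<Lambda> \<le> x \<Longrightarrow> x \<le> 3 * \<Lambda> \<Longrightarrow> M \<le> g x" "0 \<le> M"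
  shows "t * M / 2 / 2 powr a \<le> u r t"
proof (rule u_ge_divide[OF rt])
  have l: "\<Lambda> \<le> r - t" "r - t \<le> 3 * \<Lambda>" "\<Lambda> \<le> r + t" "r + t \<le> 3 * \<Lambda>" "0 \<le> t" using rt by (auto simp: region_def)
  define X where "X = t * ((r - t) powr a * M)"
  have "2 * X = integral {r - t..r + t} (\<lambda>x. (r - t) powr a * M)" using l by (simp add: X_def)
  also have "\<dots> \<le> integral {r - t..r + t} (\<lambda>x. vt x 0)"
    using l \<Lambda> a M(2)
    by (intro integral_le slice_integrable) (auto simp: vt_0 intro!: mult_mono powr_mono2 M(1))
  finally have "2 * X \<le> integral {r - t..r + t} (\<lambda>x. vt x 0)" .
  with lower_bounds(2)[OF rt] have "X / 2 \<le> r powr a * u r t" by linarith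
  then show "(r - t) powr a * (t * M / 2) \<le> r powr a * u r t" by (simp add: X_def algebra_simps)
qed

text \<open>On the triangle below \<open>(r, t)\<close>, \<open>F (u x s) \<ge> A * M powr p\<close>
  from time \<open>\<alpha>\<close> on. Stopping at the midpoint \<open>\<gamma>\<close> of
  \<open>\<alpha>\<close> and \<open>\<beta>\<close> leaves slices of half-length at least
  \<open>\<beta> - \<gamma>\<close>, which gives the factor
  \<open>(\<beta> - \<alpha>)\<^sup>2 / 4\<close> in the forcing; \<open>lower_bounds\<close> keeps
  half of it.\<close>

lemma amplify:
  assumes rt: "(r, t) \<in> region" and \<alpha>: "0 \<le> \<alpha>" "\<alpha> \<le> \<beta>" "\<beta> \<le> t" and M: "0 \<le> M"
    and u_ge: "\<And>x s. (x, s) \<in> region \<Longrightarrow> \<alpha> \<le> s \<Longrightarrow> M \<le> u x s"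
  shows "A * (\<beta> - \<alpha>)\<^sup>2 / 8 * M powr p / 2 powr a \<le> u r t"
proof (rule u_ge_divide[OF rt])
  have l: "\<Lambda> \<le> r - t" "r - t \<le> 3 * \<Lambda>" "\<Lambda> \<le> r + t" "r + t \<le> 3 * \<Lambda>" "0 \<le> t" using rt by (auto simp: region_def)
  define \<gamma> where "\<gamma> = (\<alpha> + \<beta>) / 2"
  define \<mu> where "\<mu> = (r - t) powr a * (A * M powr p)"
  have \<mu>: "0 \<le> \<mu>" using A by (simp add: \<mu>_def)
  have "(r - t) powr a * (A * (\<beta> - \<alpha>)\<^sup>2 / 8 * M powr p) = (\<gamma> - \<alpha>) * (\<beta> - \<gamma>) * \<mu> / 2"
    by (simp add: \<gamma>_def \<mu>_def power2_eq_square field_simps)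
  also have "\<dots> \<le> (\<gamma> - \<alpha>) * (t - \<gamma>) * \<mu> / 2"
    using \<alpha> \<mu> by (intro divide_right_mono mult_right_mono mult_left_mono) (auto simp: \<gamma>_def)
  also have "(\<gamma> - \<alpha>) * (t - \<gamma>) * \<mu> / 2 \<le> forcing r t / 2"
  proof (intro divide_right_mono, rule lower_bound_if_pos(3)[OF rt u_pos_all])
    fix x s assume s: "\<alpha> \<le> s" "s \<le> \<gamma>" "r - t + s \<le> x" "x \<le> r + t - s"
    have "M \<le> u x s" using s \<alpha> by (intro u_ge region_triangle[OF rt]) (auto simp: \<gamma>_def)
    then have "A * M powr p \<le> A * u x s powr p" using A M p by (intro mult_left_mono powr_mono2) auto
    also have "\<dots> \<le> F (u x s)" using \<open>M \<le> u x s\<close> M by (intro F_ge) auto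
    finally show "\<mu> \<le> x powr a * F (u x s)"
      unfolding \<mu>_def using s \<alpha> l \<Lambda> a A by (intro mult_mono powr_mono2) auto
  qed (use \<alpha> \<mu> in \<open>auto simp: \<gamma>_def\<close>)
  also note lower_bounds(3)[OF rt]
  finally show "(r - t) powr a * (A * (\<beta> - \<alpha>)\<^sup>2 / 8 * M powr p) \<le> r powr a * u r t" .
qed

text \<open>Each use of \<open>amplify\<close> spends half of the time left before \<open>T\<close>,
  so the squared time gap shrinks by a factor of 4 per step. The ratio
  \<open>4 powr (1 / (p - 1))\<close> is chosen so that the growth of \<open>M powr (p - 1)\<close>
  makes up for this exactly; \<open>large\<close> then supplies the gain.\<close>

lemma iterate:
  assumes U: "0 < U" and u_ge: "\<And>x s. (x, s) \<in> region \<Longrightarrow> T / 2 \<le> s \<Longrightarrow> U \<le> u x s"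
    and large: "4 powr (1 / (p - 1)) \<le> A * T\<^sup>2 / 128 * U powr (p - 1) / 2 powr a"
  shows "(x, s) \<in> region \<Longrightarrow> T * (1 - 1 / 2 ^ Suc k) \<le> s \<Longrightarrow> U * (4 powr (1 / (p - 1))) ^ k \<le> u x s"
proof (induction k arbitrary: x s)
  case 0
  then show ?case using u_ge by simp
next
  case (Suc k)
  define q where "q = (4::real) powr (1 / (p - 1))"
  have q: "0 < q" "q powr (p - 1) = 4" using p by (auto simp: q_def powr_powr)
  define M where "M = U * q ^ k"
  have M: "0 < M" using U q by (simp add: M_def)
  have "(q ^ k) powr (p - 1) = 4 ^ k"
    using q by (simp add: powr_realpow[symmetric] powr_powr mult.commute[of "real k"]) (simp add: powr_powr[symmetric])
  then have Mp: "M powr p = M * (U powr (p - 1) * 4 ^ k)"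
    using powr_add[of M 1 "p - 1"] M U q by (simp add: M_def powr_mult)
  have diff: "T * (1 - 1 / 2 ^ Suc (Suc k)) - T * (1 - 1 / 2 ^ Suc k) = T / (4 * 2 ^ k)"
    by (simp add: field_simps)
  have four: "(2 ^ k)\<^sup>2 = (4::real) ^ k" by (simp add: power2_eq_square flip: power_mult_distrib)
  have "U * q ^ Suc k = M * q" by (simp add: M_def)
  also have "\<dots> \<le> M * (A * T\<^sup>2 / 128 * U powr (p - 1) / 2 powr a)"
    using large M unfolding q_def by (intro mult_left_mono) auto
  \<comment> \<open>The constant 128 is \<open>8 * 4\<^sup>2\<close>, from the 8 in
    \<open>amplify\<close> and the 4 in the time gap; the powers \<open>4 ^ k\<close>
    cancel.\<close>
  also have "\<dots> = A * (T / (4 * 2 ^ k))\<^sup>2 / 8 * M powr p / 2 powr a"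
    by (simp add: Mp power_divide power_mult_distrib four)
  also have "\<dots> \<le> u x s"
    unfolding diff[symmetric]
  proof (rule amplify)
    show "T * (1 - 1 / 2 ^ Suc k) \<le> T * (1 - 1 / 2 ^ Suc (Suc k))"
      using T by (intro mult_left_mono) (auto simp: field_simps)
    have "1 / 2 ^ Suc k \<le> (1::real)" using one_le_power[of "2::real" "Suc k"] by simp
    then show "0 \<le> T * (1 - 1 / 2 ^ Suc k)" using T by simp
    show "M \<le> u x s" if "(x, s) \<in> region" "T * (1 - 1 / 2 ^ Suc k) \<le> s" for x s
      using Suc.IH[OF that] by (simp add: M_def q_def)
  qed (use Suc.prems M in auto)
  finally show ?case by (simp add: q_def)
qed

text \<open>The times in \<open>iterate\<close> stay below \<open>T\<close>, so the single point
  \<open>(2 * \<Lambda>, T)\<close> is subject to all its bounds at once.\<close>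

lemma blowup:
  assumes U: "0 < U" and u_ge: "\<And>x s. (x, s) \<in> region \<Longrightarrow> T / 2 \<le> s \<Longrightarrow> U \<le> u x s"
    and large: "4 powr (1 / (p - 1)) \<le> A * T\<^sup>2 / 128 * U powr (p - 1) / 2 powr a"
  shows False
proof -
  have "(2 * \<Lambda>, T) \<in> region" using T \<Lambda> by (auto simp: region_def)
  moreover have "T * (1 - 1 / 2 ^ Suc k) \<le> T" for k using T by simp
  ultimately have bound: "U * (4 powr (1 / (p - 1))) ^ k \<le> u (2 * \<Lambda>) T" for k
    using iterate[OF assms] by blast
  have "1 < (4::real) powr (1 / (p - 1))" using p by (intro gr_one_powr) auto
  then obtain k where "u (2 * \<Lambda>) T / U < (4 powr (1 / (p - 1))) ^ k"
    using real_arch_pow by blast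
  with bound[of k] U show False by (simp add: field_simps)
qed

end

section \<open>Choice of the scale for slowly decaying data\<close>

text \<open>With \<open>T = \<epsilon> * \<Lambda>\<close> and a starting bound \<open>U\<close> of
  order \<open>\<Lambda> powr - \<kappa>\<close>, the quantity
  \<open>T\<^sup>2 * U powr (p - 1)\<close> in \<open>blowup\<close> is of order
  \<open>\<Lambda> powr (2 - \<kappa> * (p - 1))\<close>. The exponent is positive, so a large
  \<open>\<Lambda>\<close> passes the threshold.\<close>

lemma slowly_decaying_blowup:
  fixes A B R p \<kappa> a c :: real and F f g :: "real \<Rightarrow> real" and u :: "real \<Rightarrow> real \<Rightarrow> real"
  assumes wave: "wave_with_potential (\<lambda>x t. x powr a * u x t) vx vt vxx vtt (\<lambda>x t. x powr a * F (u x t)) c"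
    and u_cont: "continuous_on ({0<..} \<times> {0..}) (\<lambda>(x, t). u x t)"
    and F_ge: "\<And>s. s \<ge> 0 \<Longrightarrow> F s \<ge> A * s powr p"
    and A: "A > 0" and p: "p > 1" and a: "a \<ge> 0"
    and \<kappa>: "0 < \<kappa>" "\<kappa> < 2 / (p - 1)" and R: "R > 0" and B: "B > 0"
    and u_init: "\<And>x. x > 0 \<Longrightarrow> u x 0 = f x" and vt_init: "\<And>x. x > 0 \<Longrightarrow> vt x 0 = x powr a * g x"
    and data: "\<And>x. x \<ge> R \<Longrightarrow> 0 < f x \<and> 0 < g x \<and> 2 * f x \<le> x * g x"
    and decay: "(\<forall>x\<ge>R. B / (1 + x) powr \<kappa> \<le> f x) \<or> (\<forall>x\<ge>R. B / (1 + x) powr (1 + \<kappa>) \<le> g x)"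
  shows False
proof -
  have c: "0 \<le> c" using wave by (simp add: wave_with_potential_def)
  define \<epsilon> where "\<epsilon> = 1 / (4 + 2 * c)"
  have \<epsilon>: "0 < \<epsilon>" "4 * \<epsilon> \<le> 1" "2 * c * \<epsilon> \<le> 1" using c by (auto simp: \<epsilon>_def field_simps)
  \<comment> \<open>\<open>4 powr \<kappa>\<close> comes from
    \<open>1 + x \<le> 4 * \<Lambda>\<close> on the base, \<open>2 powr a\<close> from removing the
    weights, and \<open>\<epsilon> / 16\<close> from the velocity case at time
    \<open>\<epsilon> * \<Lambda> / 2\<close>; the position case gives the larger factor
    \<open>1 / 2\<close>.\<close>
  define k where "k = \<epsilon> * B / (16 * 4 powr \<kappa> * 2 powr a)"
  have k: "0 < k" using \<epsilon> B by (simp add: k_def)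
  define D where "D = A * \<epsilon>\<^sup>2 / 128 / 2 powr a * k powr (p - 1)"
  have D: "0 < D" using A \<epsilon> k by (simp add: D_def)
  define \<delta> where "\<delta> = 2 - \<kappa> * (p - 1)"
  have \<delta>: "0 < \<delta>" using \<kappa> p by (simp add: \<delta>_def field_simps)
  define q where "q = (4::real) powr (1 / (p - 1))"
  \<comment> \<open>The three entries put the base where the data are controlled, give
    \<open>1 + 3 * \<Lambda> \<le> 4 * \<Lambda>\<close>, and make
    \<open>D * \<Lambda> powr \<delta>\<close> at least \<open>q\<close>.\<close>
  define \<Lambda> where "\<Lambda> = max (max R 1) ((q / D) powr (1 / \<delta>))"
  have Lambda: "R \<le> \<Lambda>" "1 \<le> \<Lambda>" "(q / D) powr (1 / \<delta>) \<le> \<Lambda>" by (auto simp: \<Lambda>_def)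
  have "0 < q" by (simp add: q_def)
  then have "q / D = ((q / D) powr (1 / \<delta>)) powr \<delta>" using D \<delta> by (simp add: powr_powr)
  also have "\<dots> \<le> \<Lambda> powr \<delta>" using Lambda \<delta> by (intro powr_mono2) auto
  finally have "q \<le> D * \<Lambda> powr \<delta>" using D by (simp add: field_simps)
  moreover have "\<Lambda> powr \<delta> = \<Lambda>\<^sup>2 * (\<Lambda> powr - \<kappa>) powr (p - 1)"
    using Lambda powr_add[of \<Lambda> 2 "- \<kappa> * (p - 1)"] by (simp add: \<delta>_def powr_powr)
  ultimately have large: "q \<le> A * (\<epsilon> * \<Lambda>)\<^sup>2 / 128 * (k * \<Lambda> powr - \<kappa>) powr (p - 1) / 2 powr a"
    using k by (simp add: D_def powr_mult power_mult_distrib mult_ac)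
  interpret radial_blowup u vx vt vxx vtt F a c g A p \<Lambda> "\<epsilon> * \<Lambda>"
  proof (intro radial_blowup.intro[OF wave] radial_blowup_axioms.intro)
    show "4 * (\<epsilon> * \<Lambda>) \<le> \<Lambda>" "2 * c * (\<epsilon> * \<Lambda>) \<le> \<Lambda>"
      using mult_right_mono[OF \<epsilon>(2), of \<Lambda>] mult_right_mono[OF \<epsilon>(3), of \<Lambda>] Lambda by (auto simp: mult.assoc)
  qed (use u_cont F_ge A p a \<epsilon> Lambda R data in \<open>auto simp: u_init vt_init intro: less_imp_le\<close>)
  have kU: "\<epsilon> / 16 * (B / (4 * \<Lambda>) powr \<kappa>) / 2 powr a = k * \<Lambda> powr - \<kappa>"
    using Lambda by (simp add: k_def powr_mult powr_minus divide_simps)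
  have mono: "B / (4 * \<Lambda>) powr e \<le> B / (1 + x) powr e" if "\<Lambda> \<le> x" "x \<le> 3 * \<Lambda>" "0 < e" for x e
    using that Lambda B by (intro divide_left_mono powr_mono2 mult_pos_pos) auto
  have "k * \<Lambda> powr - \<kappa> \<le> u x s" if xs: "(x, s) \<in> region" "\<epsilon> * \<Lambda> / 2 \<le> s" for x s
    using decay
  proof
    assume f: "\<forall>x\<ge>R. B / (1 + x) powr \<kappa> \<le> f x"
    have "B / (4 * \<Lambda>) powr \<kappa> / 2 / 2 powr a \<le> u x s"
    proof (rule initial_bound_position[OF xs(1)])
      fix y assume y: "\<Lambda> \<le> y" "y \<le> 3 * \<Lambda>"
      then have "B / (1 + y) powr \<kappa> \<le> u y 0" using f Lambda by (simp add: u_init)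
      with mono[OF y \<kappa>(1)] show "B / (4 * \<Lambda>) powr \<kappa> \<le> u y 0" by linarith
    qed
    moreover have "\<epsilon> / 16 * (B / (4 * \<Lambda>) powr \<kappa>) \<le> 1 / 2 * (B / (4 * \<Lambda>) powr \<kappa>)"
      using \<epsilon> B by (intro mult_right_mono) auto
    then have "\<epsilon> / 16 * (B / (4 * \<Lambda>) powr \<kappa>) / 2 powr a \<le> 1 / 2 * (B / (4 * \<Lambda>) powr \<kappa>) / 2 powr a"
      by (intro divide_right_mono) auto
    ultimately show ?thesis unfolding kU by simp
  next
    assume g: "\<forall>x\<ge>R. B / (1 + x) powr (1 + \<kappa>) \<le> g x"
    define M where "M = B / (4 * \<Lambda>) powr (1 + \<kappa>)"
    have M: "0 \<le> M" using B by (simp add: M_def)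
    have "s * M / 2 / 2 powr a \<le> u x s"
    proof (rule initial_bound_velocity[OF xs(1) _ M])
      fix y assume y: "\<Lambda> \<le> y" "y \<le> 3 * \<Lambda>"
      then have "B / (1 + y) powr (1 + \<kappa>) \<le> g y" using g Lambda by simp
      with mono[OF y, of "1 + \<kappa>"] \<kappa> show "M \<le> g y" by (simp add: M_def)
    qed
    moreover have "(\<epsilon> * \<Lambda> / 2) * M / 2 / 2 powr a \<le> s * M / 2 / 2 powr a"
      using xs(2) M by (intro divide_right_mono mult_right_mono) auto
    moreover have "(\<epsilon> * \<Lambda> / 2) * M / 2 / 2 powr a = \<epsilon> / 16 * (B / (4 * \<Lambda>) powr \<kappa>) / 2 powr a"
      using Lambda by (simp add: M_def powr_add divide_simps)
    ultimately show ?thesis unfolding kU by linarith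
  qed
  then show False
    using blowup[of "k * \<Lambda> powr - \<kappa>"] large k Lambda by (simp add: q_def)
qed

section \<open>Reduction of the radial equation, and the theorem\<close>

text \<open>For \<open>2 * a = n - 1\<close> the weight cancels the first-order term and leaves a
  potential with coefficient \<open>a * (a - 1)\<close>, nonnegative because
  \<open>n \<ge> 3\<close> gives \<open>a \<ge> 1\<close>.\<close>

lemma radial_solution_wave_with_potential:
  assumes sol: "radial_solution n F f g u" and F: "continuous_on UNIV F"
    and n: "n \<ge> 3" and a_def: "a = (real n - 1) / 2"
  obtains vx vt vxx vtt where
    "wave_with_potential (\<lambda>x t. x powr a * u x t) vx vt vxx vtt (\<lambda>x t. x powr a * F (u x t)) (a * (a - 1))"
    "\<forall>x>0. vt x 0 = x powr a * g x"
proof -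
  from sol obtain ur ut urr utt urt where
    deriv: "\<forall>r>0. \<forall>t\<ge>0.
          ((\<lambda>\<rho>. u \<rho> t) has_real_derivative ur r t) (at r) \<and>
          ((\<lambda>\<tau>. u r \<tau>) has_real_derivative ut r t) (at t within {0..}) \<and>
          ((\<lambda>\<rho>. ur \<rho> t) has_real_derivative urr r t) (at r) \<and>
          ((\<lambda>\<tau>. ut r \<tau>) has_real_derivative utt r t) (at t within {0..}) \<and>
          ((\<lambda>\<tau>. ur r \<tau>) has_real_derivative urt r t) (at t within {0..}) \<and>
          utt r t - (real n - 1) / r * ur r t - urr r t = F (u r t)"
    and cont: "continuous_on ({0<..} \<times> {0..}) (\<lambda>(r,t). u r t)"
       "continuous_on ({0<..} \<times> {0..}) (\<lambda>(r,t). ur r t)"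
       "continuous_on ({0<..} \<times> {0..}) (\<lambda>(r,t). ut r t)"
       "continuous_on ({0<..} \<times> {0..}) (\<lambda>(r,t). utt r t)"
    and init: "\<forall>r>0. u r 0 = f r \<and> ut r 0 = g r"
    unfolding radial_solution_def by blast
  define vx where "vx x t = x powr a * ur x t + a * x powr (a - 1) * u x t" for x t
  define vxx where "vxx x t = x powr a * urr x t + 2 * a * x powr (a - 1) * ur x t
      + a * (a - 1) * x powr (a - 2) * u x t" for x t
  show thesis
  proof (rule that)
    show "wave_with_potential (\<lambda>x t. x powr a * u x t) vx (\<lambda>x t. x powr a * ut x t) vxx
        (\<lambda>x t. x powr a * utt x t) (\<lambda>x t. x powr a * F (u x t)) (a * (a - 1))"
    proof
      fix x t :: real assume x: "0 < x" and t: "0 \<le> t"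
      note d = deriv[rule_format, OF x t]
      have pow: "((\<lambda>x. x powr b) has_real_derivative b * x powr (b - 1)) (at x)" for b
        using x by (rule has_real_derivative_powr)
      show "((\<lambda>x. x powr a * u x t) has_real_derivative vx x t) (at x)"
        unfolding vx_def using d x by (auto intro!: derivative_eq_intros pow)
      show "((\<lambda>x. vx x t) has_real_derivative vxx x t) (at x)"
        unfolding vx_def vxx_def using d x
        by (auto intro!: derivative_eq_intros pow simp: algebra_simps)
      show "((\<lambda>t. x powr a * u x t) has_real_derivative x powr a * ut x t) (at t within {0..})"
        "((\<lambda>t. x powr a * ut x t) has_real_derivative x powr a * utt x t) (at t within {0..})"
        using d by (auto intro!: derivative_eq_intros)
      have "x powr a = x powr (a - 1) * x" "x powr a = x powr (a - 2) * x\<^sup>2"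
        using x powr_add[of x "a - 1" 1] powr_add[of x "a - 2" 2] by auto
      then have "x powr (a - 1) = x powr a / x" "x powr (a - 2) = x powr a / x\<^sup>2"
        using x by (auto simp: field_simps)
      moreover have "utt x t = F (u x t) + 2 * a / x * ur x t + urr x t"
      proof -
        have "2 * a = real n - 1" by (simp add: a_def)
        with d show ?thesis by simp
      qed
      ultimately show "x powr a * utt x t - vxx x t
          = x powr a * F (u x t) - a * (a - 1) * (x powr a * u x t) / x\<^sup>2"
        unfolding vxx_def by (simp add: algebra_simps)
    next
      have pow_cont: "continuous_on ({0<..} \<times> {0..}) (\<lambda>p. fst p powr b)" for b :: real
        by (intro continuous_intros) auto
      have Fu: "continuous_on ({0<..} \<times> {0..}) (\<lambda>p. F (u (fst p) (snd p)))"
        using cont(1) by (intro continuous_on_compose2[OF F]) (auto simp: case_prod_unfold)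
      show "continuous_on ({0<..} \<times> {0..}) (\<lambda>(x, t). vx x t)"
        "continuous_on ({0<..} \<times> {0..}) (\<lambda>(x, t). x powr a * ut x t)"
        "continuous_on ({0<..} \<times> {0..}) (\<lambda>(x, t). x powr a * utt x t)"
        "continuous_on ({0<..} \<times> {0..}) (\<lambda>(x, t). x powr a * F (u x t))"
        using cont Fu pow_cont unfolding vx_def case_prod_unfold by (auto intro!: continuous_intros)
      show "0 \<le> a * (a - 1)" using n by (simp add: a_def)
    qed
  qed (use init in auto)
qed

theorem theorem2p2:
  fixes n m :: nat and p A \<kappa> R \<zeta> :: real and F f g :: "real \<Rightarrow> real"
  assumes n: "n \<ge> 4" and m: "m = n div 2"
    and p: "p > 1"
    and F_C1: "F differentiable_on UNIV" "continuous_on UNIV (deriv F)"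
    and A: "A > 0" and F_ge: "\<forall>s\<ge>0. F s \<ge> A * s powr p"
    and kappa: "0 < \<kappa>" "\<kappa> < 2 / (p - 1)"
    and f_C2: "\<forall>r>0. f differentiable (at r)" "\<forall>r>0. deriv f differentiable (at r)"
              "continuous_on {0<..} (deriv (deriv f))"
    and g_C1: "\<forall>r>0. g differentiable (at r)" "continuous_on {0<..} (deriv g)"
    and zeta: "zeta_admissible m \<zeta>"
    and R: "R > 0"
    and cases:
      "(odd n \<and>
         ((\<exists>C1>0. \<forall>r\<ge>R. f r \<ge> C1 / (1 + r) powr \<kappa> \<and> g r > 0 \<and>
                           - C1m m * f r / r + g r > 0) \<or>
          (\<exists>C2>0. \<forall>r\<ge>R. f r > 0 \<and> g r > 0 \<and>
                           - C1m m * f r / r + g r \<ge> C2 / (1 + r) powr (1 + \<kappa>))))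
       \<or> (even n \<and>
         (\<exists>C3>0. \<forall>r\<ge>R. f r > 0 \<and> g r > 0 \<and>
             - C2m m \<zeta> * f r / r - \<bar>deriv f r\<bar> + g r / 2 \<ge> C3 / (1 + r) powr (1 + \<kappa>)))"
  shows "\<not> (\<exists>u. radial_solution n F f g u)"
proof
  assume "\<exists>u. radial_solution n F f g u"
  then obtain u where sol: "radial_solution n F f g u" by blast
  define a where "a = (real n - 1) / 2"
  have F_cont: "continuous_on UNIV F" using F_C1(1) by (rule differentiable_imp_continuous_on)
  have "n \<ge> 3" using n by simp
  obtain vx vt vxx vtt where
    wave: "wave_with_potential (\<lambda>x t. x powr a * u x t) vx vt vxx vtt (\<lambda>x t. x powr a * F (u x t)) (a * (a - 1))"
    and vt_0: "\<forall>x>0. vt x 0 = x powr a * g x"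
    by (rule radial_solution_wave_with_potential[OF sol F_cont \<open>n \<ge> 3\<close> a_def])
  have u_cont: "continuous_on ({0<..} \<times> {0..}) (\<lambda>(x, t). u x t)" and u_0: "\<And>x. x > 0 \<Longrightarrow> u x 0 = f x"
    using sol by (auto simp: radial_solution_def)
  have "2 \<le> m" using n m by auto
  then have m2: "2 \<le> real m" by simp
  \<comment> \<open>The target \<open>2 * f r \<le> r * g r\<close> calls for a coefficient of at
    least 2 in the odd case; in the even case 1 suffices, since \<open>f r / r\<close> is compared
    with \<open>g r / 2\<close> there.\<close>
  have C1m: "2 \<le> C1m m" using mult_mono[of 2 "real m" 1 "real m - 1"] m2 by (simp add: C1m_def)
  have C2m: "1 \<le> C2m m \<zeta>"
  proof -
    have "0 \<le> 5 * \<zeta> * (real m - 1)\<^sup>2 / 3" using zeta by (simp add: zeta_admissible_def)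
    then show ?thesis using m2 by (simp add: C2m_def)
  qed
  have scale: "K * (f r / r) \<le> C * f r / r" "0 < f r / r" if "K \<le> C" "f r > 0" "r \<ge> R" for K C r
    using that R by (auto simp: divide_right_mono)
  have le: "2 * f r \<le> r * g r" if "2 * (f r / r) \<le> g r" "r \<ge> R" for r
    using that R by (simp add: field_simps)
  \<comment> \<open>All cases are brought to one form: sign conditions, domination of position by
    velocity, and a decay bound on \<open>f\<close> or on \<open>g\<close>. The first odd case
    yields the bound on \<open>f\<close>, the other two the bound on \<open>g\<close>.\<close>
  have "\<exists>B>0. (\<forall>r\<ge>R. 0 < f r \<and> 0 < g r \<and> 2 * f r \<le> r * g r) \<and>
      ((\<forall>r\<ge>R. B / (1 + r) powr \<kappa> \<le> f r) \<or> (\<forall>r\<ge>R. B / (1 + r) powr (1 + \<kappa>) \<le> g r))"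
    using cases
  proof (elim disjE conjE exE)
    fix C1 assume "0 < C1"
      and C1: "\<forall>r\<ge>R. C1 / (1 + r) powr \<kappa> \<le> f r \<and> 0 < g r \<and> 0 < - C1m m * f r / r + g r"
    have "0 < f r \<and> 0 < g r \<and> 2 * f r \<le> r * g r" if r: "r \<ge> R" for r
    proof -
      have "0 < C1 / (1 + r) powr \<kappa>" using \<open>0 < C1\<close> r R by simp
      then have "0 < f r" using C1 r by force
      then show ?thesis using C1 r scale(1)[OF C1m _ r] by (force intro: le)
    qed
    with \<open>0 < C1\<close> C1 show ?thesis by blast
  next
    fix C2 assume "0 < C2"
      and C2: "\<forall>r\<ge>R. 0 < f r \<and> 0 < g r \<and> C2 / (1 + r) powr (1 + \<kappa>) \<le> - C1m m * f r / r + g r"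
    have "0 < f r \<and> 0 < g r \<and> 2 * f r \<le> r * g r \<and> C2 / (1 + r) powr (1 + \<kappa>) \<le> g r"
      if r: "r \<ge> R" for r
    proof -
      have "0 \<le> C2 / (1 + r) powr (1 + \<kappa>)" using \<open>0 < C2\<close> by simp
      then show ?thesis using C2 r scale[OF C1m _ r] by (force intro: le)
    qed
    with \<open>0 < C2\<close> show ?thesis by blast
  next
    fix C3 assume "0 < C3"
      and C3: "\<forall>r\<ge>R. 0 < f r \<and> 0 < g r \<and>
        C3 / (1 + r) powr (1 + \<kappa>) \<le> - C2m m \<zeta> * f r / r - \<bar>deriv f r\<bar> + g r / 2"
    have "0 < f r \<and> 0 < g r \<and> 2 * f r \<le> r * g r \<and> C3 / (1 + r) powr (1 + \<kappa>) \<le> g r"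
      if r: "r \<ge> R" for r
    proof -
      have "0 \<le> C3 / (1 + r) powr (1 + \<kappa>)" using \<open>0 < C3\<close> by simp
      then show ?thesis using C3 r scale[OF C2m _ r] by (force intro: le)
    qed
    with \<open>0 < C3\<close> show ?thesis by blast
  qed
  then obtain B where B: "B > 0"
    and data: "\<And>r. r \<ge> R \<Longrightarrow> 0 < f r \<and> 0 < g r \<and> 2 * f r \<le> r * g r"
    and decay: "(\<forall>r\<ge>R. B / (1 + r) powr \<kappa> \<le> f r) \<or> (\<forall>r\<ge>R. B / (1 + r) powr (1 + \<kappa>) \<le> g r)"
    by blast
  have "0 \<le> a" using n by (simp add: a_def)
  from slowly_decaying_blowup[OF wave u_cont F_ge[rule_format] A p this kappa R B u_0 vt_0[rule_format] data decay]
  show False by simp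
qed

end
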